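(* Let $X$ be an ordered group, let $\mathrm{Aut}(X)$ be the group (under composition) of monotone group automorphisms of $X$, and let $\widetilde{P}=\{\alpha\in\mathrm{Aut}(X) : \alpha(x)\sim x\text{ for all }x\in X\}$. Let $\mathrm{Aut}_{\widetilde P}(X)$ be the group $\mathrm{Aut}(X)$ equipped with the order whose positive cone is $\widetilde{P}$. Then the rali point $$X\xrightarrow{\langle 1,0\rangle}X\rtimes \mathrm{Aut}_{\widetilde{P}}(X)\xrightarrow{\pi_2}\mathrm{Aut}_{\widetilde{P}}(X),\qquad \langle 0,1\rangle\colon \mathrm{Aut}_{\widetilde{P}}(X)\to X\rtimes \mathrm{Aut}_{\widetilde{P}}(X),$$ where $X\rtimes \mathrm{Aut}_{\widetilde{P}}(X)$ carries the product order (positive cone $P_X\times\widetilde P$), is a terminal object of the category $\mathsf{Rali}_X$.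
   Context: "Order" means preorder (reflexive and transitive, not necessarily antisymmetric). An ordered group is a (not necessarily abelian) group, written additively, with an order $\leq$ for which addition is monotone. Write $x\sim y$ for $x\leq y$ and $y\leq x$. The positive cone of an ordered group $X$ is $P_X=\{x\in X: x\geq 0\}$; a positive cone on a group is a submonoid closed under conjugation, and positive cones correspond bijectively to group orders. $\mathsf{OrdGrp}$ is the category of ordered groups and monotone group homomorphisms. A monotone automorphism of $X$ is a group automorphism of $X$ that is monotone. The group $X\rtimes\mathrm{Aut}(X)$ has underlying set $X\times\mathrm{Aut}(X)$ and operation $(x,\alpha)+(x',\alpha')=(x+\alpha(x'),\alpha\cdot\alpha')$; $\langle 1,0\rangle(x)=(x,\mathrm{id})$, $\pi_2(x,\alpha)=\alpha$, $\langle 0,1\rangle(\alpha)=(0,\alpha)$. A split extension in $\mathsf{OrdGrp}$ with kernel $X$ is a sequence $X\xrightarrow{k}A\xrightarrow{f}B$ with $k$ a kernel of $f$ and $f$ a cokernel of $k$, together with a morphism $s\colon B\to A$ such that $f\cdot s=\mathrm{id}_B$ (a kernel in $\mathsf{OrdGrp}$ is the group-theoretic kernel with the induced order); it is also called the point $(f,s)$. For morphisms $g,h\colon Y\to Z$ in $\mathsf{OrdGrp}$, $g\leq h$ means $g(y)\leq h(y)$ for every positive $y\in Y$; the point $(f,s)$ is a rali if $s\cdot f\leq\mathrm{id}_A$. $\mathsf{Rali}_X$ is the category whose objects are the split extensions in $\mathsf{OrdGrp}$ with kernel $X$ whose point $(f,s)$ is a rali, and whose morphisms from $(k,f,s)$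 (with $f\colon A\to B$) to $(k',f',s')$ (with $f'\colon A'\to B'$) are pairs of morphisms $b\colon A\to A'$, $c\colon B\to B'$ in $\mathsf{OrdGrp}$ with $b\cdot k=k'$, $f'\cdot b=c\cdot f$ and $b\cdot s=s'\cdot c$.
   Formalization: Aut(X) is taken to be the monotone group automorphisms whose inverse is also monotone; without this Aut(X) need not be a group (X = ℤ² with cone ℕ² and (x,y) ↦ (x+y,y)). Where it is a group, the two definitions agree. *)

theory Defs
  imports "HOL-Algebra.Coset" "HOL-Algebra.Bij"
begin

text \<open>
  Groups are written multiplicatively, following HOL-Algebra. The order is only required to be a
  preorder, and its values outside the carrier are irrelevant.
\<close>

record 'a ordgrp = "'a monoid" +
  ple :: "'a \<Rightarrow> 'a \<Rightarrow> bool" (infix \<open>\<preceq>\<index>\<close> 50)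

locale ordered_group = group G for G (structure) +
  assumes ple_refl: "x \<in> carrier G \<Longrightarrow> x \<preceq> x"
    and ple_trans:
      "\<lbrakk>x \<in> carrier G; y \<in> carrier G; z \<in> carrier G; x \<preceq> y; y \<preceq> z\<rbrakk> \<Longrightarrow> x \<preceq> z"
    and ple_mono:
      "\<lbrakk>x \<in> carrier G; y \<in> carrier G; x' \<in> carrier G; y' \<in> carrier G; x \<preceq> y; x' \<preceq> y'\<rbrakk>
        \<Longrightarrow> x \<otimes> x' \<preceq> y \<otimes> y'"

definition pos_cone :: "'a ordgrp \<Rightarrow> 'a set" where
  "pos_cone G = {x \<in> carrier G. \<one>\<^bsub>G\<^esub> \<preceq>\<^bsub>G\<^esub> x}"

definition peq :: "'a ordgrp \<Rightarrow> 'a \<Rightarrow> 'a \<Rightarrow> bool" where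
  "peq G x y \<longleftrightarrow> x \<preceq>\<^bsub>G\<^esub> y \<and> y \<preceq>\<^bsub>G\<^esub> x"

definition with_cone :: "('a, 'm) monoid_scheme \<Rightarrow> 'a set \<Rightarrow> 'a ordgrp" where
  "with_cone G P =
     \<lparr>carrier = carrier G, monoid.mult = monoid.mult G, one = one G,
      ple = (\<lambda>x y. y \<otimes>\<^bsub>G\<^esub> inv\<^bsub>G\<^esub> x \<in> P)\<rparr>"

text \<open>
  The category of ordered groups. Morphisms are taken extensional, so that equality of HOL
  functions is equality of morphisms; composition is \<^const>\<open>compose\<close> on the source carrier.
\<close>

definition ordhom :: "'a ordgrp \<Rightarrow> 'b ordgrp \<Rightarrow> ('a \<Rightarrow> 'b) set" where
  "ordhom G H = {h \<in> hom G H \<inter> extensional (carrier G).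
     \<forall>x\<in>carrier G. \<forall>y\<in>carrier G. x \<preceq>\<^bsub>G\<^esub> y \<longrightarrow> h x \<preceq>\<^bsub>H\<^esub> h y}"

definition id_mor :: "'a ordgrp \<Rightarrow> 'a \<Rightarrow> 'a" where
  "id_mor G = (\<lambda>x\<in>carrier G. x)"

definition zero_mor :: "'a ordgrp \<Rightarrow> 'b ordgrp \<Rightarrow> 'a \<Rightarrow> 'b" where
  "zero_mor G H = (\<lambda>x\<in>carrier G. \<one>\<^bsub>H\<^esub>)"

definition mor_le :: "'a ordgrp \<Rightarrow> 'b ordgrp \<Rightarrow> ('a \<Rightarrow> 'b) \<Rightarrow> ('a \<Rightarrow> 'b) \<Rightarrow> bool" where
  "mor_le Y Z g h \<longleftrightarrow> (\<forall>y\<in>pos_cone Y. g y \<preceq>\<^bsub>Z\<^esub> h y)"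

definition is_kernel ::
    "'x ordgrp \<Rightarrow> 'a ordgrp \<Rightarrow> 'b ordgrp \<Rightarrow> ('x \<Rightarrow> 'a) \<Rightarrow> ('a \<Rightarrow> 'b) \<Rightarrow> bool" where
  "is_kernel X A B k f \<longleftrightarrow>
     k \<in> ordhom X A \<and> f \<in> ordhom A B \<and>
     bij_betw k (carrier X) (kernel A B f) \<and>
     (\<forall>x\<in>carrier X. \<forall>y\<in>carrier X. x \<preceq>\<^bsub>X\<^esub> y \<longleftrightarrow> k x \<preceq>\<^bsub>A\<^esub> k y)"

text \<open>
  The universal property of a cokernel quantifies over all ordered groups, which HOL can only
  express for the ordered groups over one type at a time. That type is the explicit first argument;
  a statement that leaves it as a type variable covers all of them.
\<close>

definition is_cokernel ::
    "'c itself \<Rightarrow> 'x ordgrp \<Rightarrow> 'a ordgrp \<Rightarrow> 'b ordgrp \<Rightarrow> ('x \<Rightarrow> 'a) \<Rightarrow> ('a \<Rightarrow> 'b) \<Rightarrow> bool" where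
  "is_cokernel U X A B k f \<longleftrightarrow>
     k \<in> ordhom X A \<and> f \<in> ordhom A B \<and>
     compose (carrier X) f k = zero_mor X B \<and>
     (\<forall>(C :: 'c ordgrp) g.
        ordered_group C \<longrightarrow> g \<in> ordhom A C \<longrightarrow> compose (carrier X) g k = zero_mor X C \<longrightarrow>
        (\<exists>!h. h \<in> ordhom B C \<and> compose (carrier A) h f = g))"

record ('x, 'a, 'b) point =
  Total :: "'a ordgrp"
  Base :: "'b ordgrp"
  ker_map :: "'x \<Rightarrow> 'a"
  proj :: "'a \<Rightarrow> 'b"
  sect :: "'b \<Rightarrow> 'a"

definition split_ext :: "'c itself \<Rightarrow> 'x ordgrp \<Rightarrow> ('x, 'a, 'b) point \<Rightarrow> bool" where
  "split_ext U X E \<longleftrightarrow>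
     ordered_group (Total E) \<and> ordered_group (Base E) \<and>
     is_kernel X (Total E) (Base E) (ker_map E) (proj E) \<and>
     is_cokernel U X (Total E) (Base E) (ker_map E) (proj E) \<and>
     sect E \<in> ordhom (Base E) (Total E) \<and>
     compose (carrier (Base E)) (proj E) (sect E) = id_mor (Base E)"

definition rali :: "('x, 'a, 'b) point \<Rightarrow> bool" where
  "rali E \<longleftrightarrow>
     mor_le (Total E) (Total E)
       (compose (carrier (Total E)) (sect E) (proj E)) (id_mor (Total E))"

definition rali_obj :: "'c itself \<Rightarrow> 'x ordgrp \<Rightarrow> ('x, 'a, 'b) point \<Rightarrow> bool" where
  "rali_obj U X E \<longleftrightarrow> split_ext U X E \<and> rali E"

definition rali_hom ::
    "'x ordgrp \<Rightarrow> ('x, 'a, 'b) point \<Rightarrow> ('x, 'd, 'e) point \<Rightarrow> (('a \<Rightarrow> 'd) \<times> ('b \<Rightarrow> 'e)) set" where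
  "rali_hom X E E' = {(b, c).
     b \<in> ordhom (Total E) (Total E') \<and> c \<in> ordhom (Base E) (Base E') \<and>
     compose (carrier X) b (ker_map E) = ker_map E' \<and>
     compose (carrier (Total E)) (proj E') b = compose (carrier (Total E)) c (proj E) \<and>
     compose (carrier (Base E)) b (sect E) = compose (carrier (Base E)) (sect E') c}"

text \<open>
  A monotone bijective endomorphism of a preordered group need not have a monotone inverse, so
  monotonicity of the inverse is imposed: otherwise these maps would only form a monoid.
\<close>

definition Aut :: "'x ordgrp \<Rightarrow> ('x \<Rightarrow> 'x) monoid" where
  "Aut X = BijGroup (carrier X)
     \<lparr>carrier := {\<alpha> \<in> auto X. \<alpha> \<in> ordhom X X \<and> inv\<^bsub>AutoGroup X\<^esub> \<alpha> \<in> ordhom X X}\<rparr>"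

definition aut_cone :: "'x ordgrp \<Rightarrow> ('x \<Rightarrow> 'x) set" where
  "aut_cone X = {\<alpha> \<in> carrier (Aut X). \<forall>x\<in>carrier X. peq X (\<alpha> x) x}"

definition AutP :: "'x ordgrp \<Rightarrow> ('x \<Rightarrow> 'x) ordgrp" where
  "AutP X = with_cone (Aut X) (aut_cone X)"

definition semidirect :: "'x ordgrp \<Rightarrow> ('x \<times> ('x \<Rightarrow> 'x)) monoid" where
  "semidirect X =
     \<lparr>carrier = carrier X \<times> carrier (Aut X),
      monoid.mult = (\<lambda>(x, \<alpha>) (x', \<alpha>'). (x \<otimes>\<^bsub>X\<^esub> \<alpha> x', \<alpha> \<otimes>\<^bsub>Aut X\<^esub> \<alpha>')),
      one = (\<one>\<^bsub>X\<^esub>, \<one>\<^bsub>Aut X\<^esub>)\<rparr>"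

definition aut_point :: "'x ordgrp \<Rightarrow> ('x, 'x \<times> ('x \<Rightarrow> 'x), 'x \<Rightarrow> 'x) point" where
  "aut_point X =
     \<lparr>Total = with_cone (semidirect X) (pos_cone X \<times> aut_cone X),
      Base = AutP X,
      ker_map = (\<lambda>x\<in>carrier X. (x, \<one>\<^bsub>Aut X\<^esub>)),
      proj = (\<lambda>p\<in>carrier (semidirect X). snd p),
      sect = (\<lambda>\<alpha>\<in>carrier (Aut X). (\<one>\<^bsub>X\<^esub>, \<alpha>))\<rparr>"

end

theory Submission
  imports Defs
begin

text \<open>
  In a point \<open>(f, s)\<close> with kernel \<open>k\<close>, the base acts on \<open>X\<close> by conjugation through \<open>s\<close>, and every
  element of the total group is \<open>k x\<close> times \<open>s b\<close> for a unique pair \<open>(x, b)\<close>. A morphism to the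
  automorphism point is forced on both factors: on the base it is the action, and on the total
  group it sends \<open>k x\<close> times \<open>s b\<close> to the pair of \<open>x\<close> and the action of \<open>b\<close>. The rali condition
  makes both maps monotone: it says that the \<open>X\<close>-part of a positive element is positive, and,
  applied to the conjugates of \<open>s b\<close> with \<open>b\<close> positive, that \<open>b\<close> acts by \<open>\<alpha>\<close> with
  \<open>\<alpha>(x) \<sim> x\<close>.
\<close>

section \<open>Ordered groups and their positive cones\<close>

lemma (in group) inv_cancel_left [simp]:
  assumes "x \<in> carrier G" "y \<in> carrier G"
  shows "inv x \<otimes> (x \<otimes> y) = y" "x \<otimes> (inv x \<otimes> y) = y"
  using assms by (simp_all flip: m_assoc)

lemma ordered_group_conj_mono:
  fixes G (structure)
  assumes "ordered_group G" and "x \<in> carrier G" "y \<in> carrier G" "g \<in> carrier G" "h \<in> carrier G"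
    and "x \<preceq> y"
  shows "g \<otimes> x \<otimes> h \<preceq> g \<otimes> y \<otimes> h"
proof -
  interpret ordered_group G by fact
  show ?thesis
    using assms by (intro ple_mono m_closed ple_refl)
qed

text \<open>Multiplication on the right by \<open>inv x\<close>, and back by \<open>x\<close>,
  preserves the order. Comparisons thereby turn into membership in a cone.\<close>

lemma ple_iff_pos_cone:
  fixes G (structure)
  assumes "ordered_group G" and x: "x \<in> carrier G" and y: "y \<in> carrier G"
  shows "x \<preceq> y \<longleftrightarrow> y \<otimes> inv x \<in> pos_cone G"
proof -
  interpret ordered_group G by fact
  have "\<one> \<preceq> y \<otimes> inv x" if "x \<preceq> y"
    using ordered_group_conj_mono[OF assms one_closed, of "inv x"] that x y by simp
  moreover have "x \<preceq> y" if "\<one> \<preceq> y \<otimes> inv x"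
    using ordered_group_conj_mono[OF assms(1) one_closed _ one_closed x that] x y
    by (simp add: m_assoc)
  ultimately show ?thesis
    using x y by (auto simp: pos_cone_def)
qed

lemma pos_cone_conj:
  fixes G (structure)
  assumes "ordered_group G" and "p \<in> pos_cone G" "g \<in> carrier G"
  shows "g \<otimes> p \<otimes> inv g \<in> pos_cone G"
proof -
  interpret ordered_group G by fact
  show ?thesis
    using ordered_group_conj_mono[OF assms(1) one_closed, of p g "inv g"] assms(2,3)
    by (auto simp: pos_cone_def)
qed

text \<open>Multiply the inequality by the inverse of \<open>x\<close> on the left and by that of
  \<open>y\<close> on the right.\<close>

lemma inv_antimono:
  assumes "ordered_group G" and x: "x \<in> carrier G" and y: "y \<in> carrier G"
    and "x \<preceq>\<^bsub>G\<^esub> y"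
  shows "inv\<^bsub>G\<^esub> y \<preceq>\<^bsub>G\<^esub> inv\<^bsub>G\<^esub> x"
proof -
  interpret ordered_group G by fact
  show ?thesis
    using ordered_group_conj_mono[OF assms(1-3), of "inv\<^bsub>G\<^esub> x" "inv\<^bsub>G\<^esub> y"] assms(4) x y
    by (simp add: m_assoc)
qed

text \<open>A homomorphism sends the quotient \<open>y \<otimes> inv x\<close> to the quotient of
  the images, so preserving the cone is the same as preserving the order. The maps of the
  automorphism point and both components of the terminal morphism are shown monotone this
  way.\<close>

lemma ordhomI_pos_cone:
  assumes "ordered_group G" "ordered_group H" "h \<in> hom G H" "h \<in> extensional (carrier G)"
    and "\<And>x. x \<in> pos_cone G \<Longrightarrow> h x \<in> pos_cone H"
  shows "h \<in> ordhom G H"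
proof -
  interpret G: ordered_group G by fact
  interpret H: ordered_group H by fact
  interpret group_hom G H h
    using assms(3) by unfold_locales
  show ?thesis
    using assms by (auto simp: ordhom_def ple_iff_pos_cone simp flip: hom_inv hom_mult)
qed

lemma ordhom_pos_cone:
  assumes "ordered_group G" "ordered_group H" "h \<in> ordhom G H" "x \<in> pos_cone G"
  shows "h x \<in> pos_cone H"
proof -
  interpret G: ordered_group G by fact
  interpret H: ordered_group H by fact
  interpret group_hom G H h
    using assms(3) by unfold_locales (simp add: ordhom_def)
  have "x \<in> carrier G" "h \<one>\<^bsub>G\<^esub> \<preceq>\<^bsub>H\<^esub> h x"
    using assms(3,4) by (simp_all add: ordhom_def pos_cone_def del: hom_one)
  then show ?thesis
    by (simp add: pos_cone_def)
qed

section \<open>Orders defined by a cone\<close>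

lemma with_cone_simps [simp]:
  "carrier (with_cone G P) = carrier G"
  "monoid.mult (with_cone G P) = monoid.mult G"
  "one (with_cone G P) = one G"
  "ple (with_cone G P) x y \<longleftrightarrow> y \<otimes>\<^bsub>G\<^esub> inv\<^bsub>G\<^esub> x \<in> P"
  by (simp_all add: with_cone_def)

lemma hom_with_cone [simp]:
  "hom (with_cone G P) H = hom G H" "hom H (with_cone G P) = hom H G"
  by (simp_all add: hom_def)

lemma m_inv_with_cone [simp]: "inv\<^bsub>with_cone G P\<^esub> x = inv\<^bsub>G\<^esub> x"
  by (simp add: m_inv_def)

lemma group_with_cone:
  assumes "group G"
  shows "group (with_cone G P)"
proof -
  interpret group G by fact
  show ?thesis
    by (rule groupI) (auto simp: m_assoc intro: bexI[of _ "inv\<^bsub>G\<^esub> _"])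
qed

lemma pos_cone_with_cone:
  assumes "group G" "P \<subseteq> carrier G"
  shows "pos_cone (with_cone G P) = P"
proof -
  interpret group G by fact
  show ?thesis
    using assms(2) by (auto simp: pos_cone_def)
qed

text \<open>Closure under products gives transitivity, because the quotients telescope. Monotonicity
  of multiplication in both arguments also needs closure under conjugation.\<close>

lemma ordered_group_with_cone:
  fixes G (structure)
  assumes "group G" and P: "P \<subseteq> carrier G" and one: "\<one> \<in> P"
    and mult: "\<And>p q. p \<in> P \<Longrightarrow> q \<in> P \<Longrightarrow> p \<otimes> q \<in> P"
    and conj: "\<And>p g. p \<in> P \<Longrightarrow> g \<in> carrier G \<Longrightarrow> g \<otimes> p \<otimes> inv g \<in> P"
  shows "ordered_group (with_cone G P)"
proof -
  interpret group G by fact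
  interpret C: group "with_cone G P"
    by (rule group_with_cone) fact
  show ?thesis
  proof
    fix x y z assume *: "x \<in> carrier (with_cone G P)" "y \<in> carrier (with_cone G P)"
      "z \<in> carrier (with_cone G P)" "x \<preceq>\<^bsub>with_cone G P\<^esub> y" "y \<preceq>\<^bsub>with_cone G P\<^esub> z"
    have "(z \<otimes> inv y) \<otimes> (y \<otimes> inv x) = z \<otimes> inv x"
      using *(1-3) by (simp add: m_assoc)
    with * show "x \<preceq>\<^bsub>with_cone G P\<^esub> z"
      using mult[of "z \<otimes> inv y" "y \<otimes> inv x"] by simp
  next
    fix x y x' y' assume *: "x \<in> carrier (with_cone G P)" "y \<in> carrier (with_cone G P)"
      "x' \<in> carrier (with_cone G P)" "y' \<in> carrier (with_cone G P)"
      "x \<preceq>\<^bsub>with_cone G P\<^esub> y" "x' \<preceq>\<^bsub>with_cone G P\<^esub> y'"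
    \<comment> \<open>Conjugating the second quotient by \<open>y\<close> makes the product with the
      first one collapse to the quotient of the two products.\<close>
    have "(y \<otimes> (y' \<otimes> inv x') \<otimes> inv y) \<otimes> (y \<otimes> inv x) = (y \<otimes> y') \<otimes> inv (x \<otimes> x')"
      using *(1-4) by (simp add: m_assoc inv_mult_group)
    with * show "x \<otimes>\<^bsub>with_cone G P\<^esub> x' \<preceq>\<^bsub>with_cone G P\<^esub> y \<otimes>\<^bsub>with_cone G P\<^esub> y'"
      using mult[OF conj, of "y' \<otimes> inv x'" y "y \<otimes> inv x"] by simp
  qed (use one in simp)
qed

section \<open>The group of order automorphisms\<close>

context
  fixes X :: "'x ordgrp" (structure)
  assumes X: "ordered_group X"
begin

interpretation ordered_group X
  by (rule X)

text \<open>Since \<alpha> is onto, its inverse is monotone exactly when \<alpha> reflects the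
  order. This trades the condition on the inverse in \<open>AutoGroup X\<close> for one on \<alpha>
  alone.\<close>

lemma Aut_iff:
  "\<alpha> \<in> carrier (Aut X) \<longleftrightarrow> \<alpha> \<in> hom X X \<and> \<alpha> \<in> Bij (carrier X) \<and>
     (\<forall>x\<in>carrier X. \<forall>y\<in>carrier X. \<alpha> x \<preceq> \<alpha> y \<longleftrightarrow> x \<preceq> y)"
proof (cases "\<alpha> \<in> auto X")
  case True
  then have bij: "bij_betw \<alpha> (carrier X) (carrier X)" and B: "\<alpha> \<in> Bij (carrier X)"
    and h: "\<alpha> \<in> hom X X"
    by (auto simp: auto_def Bij_def)
  define \<beta> where "\<beta> = (\<lambda>x\<in>carrier X. inv_into (carrier X) \<alpha> x)"
  \<comment> \<open>\<open>AutoGroup X\<close> is a subgroup of the group of bijections, so its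
    inverses are the restricted set-theoretic ones.\<close>
  have inv: "inv\<^bsub>AutoGroup X\<^esub> \<alpha> = \<beta>"
    using True unfolding AutoGroup_def \<beta>_def
    by (simp add: group.m_inv_consistent[OF group_BijGroup subgroup_auto] inv_BijGroup B)
  have \<beta>: "\<beta> \<in> hom X X" "\<beta> \<in> extensional (carrier X)"
    unfolding \<beta>_def using restrict_inv_into_hom[OF h B] by auto
  have \<beta>\<alpha>: "\<beta> (\<alpha> x) = x" if "x \<in> carrier X" for x
    using that bij by (simp add: \<beta>_def bij_betw_inv_into_left bij_betwE)
  \<comment> \<open>Quantifying over the image of \<alpha> makes every bound variable of the form
    \<open>\<alpha> x\<close>, on which \<beta> cancels.\<close>
  have "(\<forall>x\<in>carrier X. \<forall>y\<in>carrier X. x \<preceq> y \<longrightarrow> \<beta> x \<preceq> \<beta> y) \<longleftrightarrow>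
      (\<forall>x\<in>\<alpha> ` carrier X. \<forall>y\<in>\<alpha> ` carrier X. x \<preceq> y \<longrightarrow> \<beta> x \<preceq> \<beta> y)"
    using bij by (simp add: bij_betw_def)
  also have "\<dots> \<longleftrightarrow> (\<forall>x\<in>carrier X. \<forall>y\<in>carrier X. \<alpha> x \<preceq> \<alpha> y \<longrightarrow> x \<preceq> y)"
    by (simp add: \<beta>\<alpha>)
  finally have "\<beta> \<in> ordhom X X \<longleftrightarrow>
      (\<forall>x\<in>carrier X. \<forall>y\<in>carrier X. \<alpha> x \<preceq> \<alpha> y \<longrightarrow> x \<preceq> y)"
    using \<beta> by (simp add: ordhom_def)
  moreover have "\<alpha> \<in> ordhom X X \<longleftrightarrow>
      (\<forall>x\<in>carrier X. \<forall>y\<in>carrier X. x \<preceq> y \<longrightarrow> \<alpha> x \<preceq> \<alpha> y)"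
    using h B by (simp add: ordhom_def Bij_def)
  moreover have "\<alpha> \<in> carrier (Aut X) \<longleftrightarrow> \<alpha> \<in> ordhom X X \<and> \<beta> \<in> ordhom X X"
    using True by (simp add: Aut_def inv)
  ultimately show ?thesis
    using h B by blast
qed (auto simp: Aut_def auto_def)

lemma Aut_hom: "\<alpha> \<in> carrier (Aut X) \<Longrightarrow> \<alpha> \<in> hom X X"
  and Aut_Bij: "\<alpha> \<in> carrier (Aut X) \<Longrightarrow> \<alpha> \<in> Bij (carrier X)"
  and Aut_ple: "\<alpha> \<in> carrier (Aut X) \<Longrightarrow> x \<in> carrier X \<Longrightarrow> y \<in> carrier X \<Longrightarrow>
     \<alpha> x \<preceq> \<alpha> y \<longleftrightarrow> x \<preceq> y"
  by (auto simp: Aut_iff)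

lemma Aut_extensional: "\<alpha> \<in> carrier (Aut X) \<Longrightarrow> \<alpha> \<in> extensional (carrier X)"
  by (simp add: Aut_Bij Bij_imp_extensional)

lemma Aut_closed [simp]: "\<alpha> \<in> carrier (Aut X) \<Longrightarrow> x \<in> carrier X \<Longrightarrow> \<alpha> x \<in> carrier X"
  using Aut_hom by (auto simp: hom_def)

lemma Aut_mult [simp]:
  "\<alpha> \<in> carrier (Aut X) \<Longrightarrow> x \<in> carrier X \<Longrightarrow> y \<in> carrier X \<Longrightarrow> \<alpha> (x \<otimes> y) = \<alpha> x \<otimes> \<alpha> y"
  using Aut_hom by (auto simp: hom_def)

lemma Aut_one [simp]: "\<alpha> \<in> carrier (Aut X) \<Longrightarrow> \<alpha> \<one> = \<one>"
  using hom_one[OF Aut_hom is_group is_group] .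

lemma mult_Aut:
  assumes "\<alpha> \<in> carrier (Aut X)" "\<beta> \<in> carrier (Aut X)"
  shows "\<alpha> \<otimes>\<^bsub>Aut X\<^esub> \<beta> = compose (carrier X) \<alpha> \<beta>"
proof -
  have "\<alpha> \<in> Bij (carrier X)" "\<beta> \<in> Bij (carrier X)"
    using assms by (simp_all add: Aut_Bij)
  then show ?thesis
    by (simp add: Aut_def BijGroup_def)
qed

lemma mult_Aut_apply [simp]:
  "\<alpha> \<in> carrier (Aut X) \<Longrightarrow> \<beta> \<in> carrier (Aut X) \<Longrightarrow> x \<in> carrier X \<Longrightarrow>
    (\<alpha> \<otimes>\<^bsub>Aut X\<^esub> \<beta>) x = \<alpha> (\<beta> x)"
  by (simp add: mult_Aut compose_def)

lemma one_Aut: "\<one>\<^bsub>Aut X\<^esub> = (\<lambda>x\<in>carrier X. x)"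
  by (simp add: Aut_def BijGroup_def)

lemma one_Aut_apply [simp]: "x \<in> carrier X \<Longrightarrow> \<one>\<^bsub>Aut X\<^esub> x = x"
  by (simp add: one_Aut)

lemma subgroup_Aut: "subgroup (carrier (Aut X)) (BijGroup (carrier X))"
proof (rule group.subgroupI[OF group_BijGroup])
  have "carrier (Aut X) \<subseteq> Bij (carrier X)"
    using Aut_Bij by blast
  then show "carrier (Aut X) \<subseteq> carrier (BijGroup (carrier X))"
    by (simp add: BijGroup_def)
  show "carrier (Aut X) \<noteq> {}"
    using id_in_auto by (force simp: Aut_iff auto_def)
  fix \<alpha> assume \<alpha>: "\<alpha> \<in> carrier (Aut X)"
  define \<beta> where "\<beta> = (\<lambda>x\<in>carrier X. inv_into (carrier X) \<alpha> x)"
  have \<beta>: "\<beta> \<in> hom X X" "\<beta> \<in> Bij (carrier X)"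
    unfolding \<beta>_def
    using restrict_inv_into_hom[OF Aut_hom Aut_Bij] restrict_inv_into_Bij[OF Aut_Bij] \<alpha> by auto
  have "bij_betw \<alpha> (carrier X) (carrier X)"
    using Aut_Bij[OF \<alpha>] by (simp add: Bij_def)
  then have "\<alpha> (\<beta> x) = x" if "x \<in> carrier X" for x
    using that by (simp add: \<beta>_def bij_betw_inv_into_right)
  moreover have "\<beta> x \<in> carrier X" if "x \<in> carrier X" for x
    using \<beta>(1) that by (auto simp: hom_def)
  \<comment> \<open>The order condition for \<beta> is the one for \<alpha> at
    \<open>\<beta> x\<close> and \<open>\<beta> y\<close>, read backwards.\<close>
  ultimately have "\<beta> \<in> carrier (Aut X)"
    using \<beta> Aut_ple[OF \<alpha>] by (metis Aut_iff)
  then show "inv\<^bsub>BijGroup (carrier X)\<^esub> \<alpha> \<in> carrier (Aut X)"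
    using Aut_Bij[OF \<alpha>] by (simp add: inv_BijGroup \<beta>_def)
  fix \<beta> assume \<beta>: "\<beta> \<in> carrier (Aut X)"
  have "\<alpha> \<otimes>\<^bsub>BijGroup (carrier X)\<^esub> \<beta> = compose (carrier X) \<alpha> \<beta>"
    using mult_Aut[OF \<alpha> \<beta>] by (simp add: Aut_def)
  moreover have "compose (carrier X) \<alpha> \<beta> \<in> carrier (Aut X)"
    unfolding Aut_iff
    using hom_compose[OF Aut_hom[OF \<beta>] Aut_hom[OF \<alpha>]] \<alpha> \<beta>
    by (simp add: Aut_Bij compose_Bij compose_eq Aut_ple)
  ultimately show "\<alpha> \<otimes>\<^bsub>BijGroup (carrier X)\<^esub> \<beta> \<in> carrier (Aut X)"
    by simp
qed

lemma group_Aut: "group (Aut X)"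
  using group.subgroup_imp_group[OF group_BijGroup subgroup_Aut] by (simp add: Aut_def)

interpretation A: group "Aut X"
  by (rule group_Aut)

lemma inv_Aut_apply [simp]:
  assumes "\<alpha> \<in> carrier (Aut X)" "x \<in> carrier X"
  shows "(inv\<^bsub>Aut X\<^esub> \<alpha>) (\<alpha> x) = x" "\<alpha> ((inv\<^bsub>Aut X\<^esub> \<alpha>) x) = x"
proof -
  show "(inv\<^bsub>Aut X\<^esub> \<alpha>) (\<alpha> x) = x"
    using assms mult_Aut_apply[of "inv\<^bsub>Aut X\<^esub> \<alpha>" \<alpha> x] by (simp del: mult_Aut_apply)
  show "\<alpha> ((inv\<^bsub>Aut X\<^esub> \<alpha>) x) = x"
    using assms mult_Aut_apply[of \<alpha> "inv\<^bsub>Aut X\<^esub> \<alpha>" x] by (simp del: mult_Aut_apply)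
qed

section \<open>The semidirect product\<close>

lemma semidirect_simps [simp]:
  "carrier (semidirect X) = carrier X \<times> carrier (Aut X)"
  "(x, \<alpha>) \<otimes>\<^bsub>semidirect X\<^esub> (y, \<beta>) = (x \<otimes> \<alpha> y, \<alpha> \<otimes>\<^bsub>Aut X\<^esub> \<beta>)"
  "\<one>\<^bsub>semidirect X\<^esub> = (\<one>, \<one>\<^bsub>Aut X\<^esub>)"
  by (simp_all add: semidirect_def)

lemma group_semidirect: "group (semidirect X)"
proof (rule groupI)
  fix p assume "p \<in> carrier (semidirect X)"
  then obtain x \<alpha> where p: "p = (x, \<alpha>)" "x \<in> carrier X" "\<alpha> \<in> carrier (Aut X)"
    by auto
  \<comment> \<open>The second component of a left inverse must be the inverse of \<alpha>. The
    first then has to cancel the image of \<open>x\<close> under that inverse, so it is the image of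
    \<open>inv x\<close>.\<close>
  show "\<exists>q\<in>carrier (semidirect X). q \<otimes>\<^bsub>semidirect X\<^esub> p = \<one>\<^bsub>semidirect X\<^esub>"
    by (rule bexI[of _ "((inv\<^bsub>Aut X\<^esub> \<alpha>) (inv x), inv\<^bsub>Aut X\<^esub> \<alpha>)"])
      (use p in \<open>simp_all flip: Aut_mult\<close>)
qed (auto simp: m_assoc A.m_assoc)

interpretation S: group "semidirect X"
  by (rule group_semidirect)

lemma inv_semidirect [simp]:
  assumes "x \<in> carrier X" "\<alpha> \<in> carrier (Aut X)"
  shows "inv\<^bsub>semidirect X\<^esub> (x, \<alpha>) = ((inv\<^bsub>Aut X\<^esub> \<alpha>) (inv x), inv\<^bsub>Aut X\<^esub> \<alpha>)"
  by (rule S.inv_equality) (use assms in \<open>simp_all flip: Aut_mult\<close>)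

section \<open>The cone of automorphisms equivalent to the identity\<close>

lemma aut_cone_iff:
  "\<alpha> \<in> aut_cone X \<longleftrightarrow> \<alpha> \<in> carrier (Aut X) \<and> (\<forall>x\<in>carrier X. \<alpha> x \<preceq> x \<and> x \<preceq> \<alpha> x)"
  by (auto simp: aut_cone_def peq_def)

lemma one_aut_cone: "\<one>\<^bsub>Aut X\<^esub> \<in> aut_cone X"
  by (simp add: aut_cone_iff ple_refl)

lemma mult_aut_cone:
  assumes "\<alpha> \<in> aut_cone X" "\<beta> \<in> aut_cone X"
  shows "\<alpha> \<otimes>\<^bsub>Aut X\<^esub> \<beta> \<in> aut_cone X"
  unfolding aut_cone_iff
proof (intro conjI ballI)
  have *: "\<alpha> \<in> carrier (Aut X)" "\<beta> \<in> carrier (Aut X)"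
    using assms by (auto simp: aut_cone_iff)
  then show "\<alpha> \<otimes>\<^bsub>Aut X\<^esub> \<beta> \<in> carrier (Aut X)"
    by simp
  fix x assume "x \<in> carrier X"
  with * assms show "(\<alpha> \<otimes>\<^bsub>Aut X\<^esub> \<beta>) x \<preceq> x" "x \<preceq> (\<alpha> \<otimes>\<^bsub>Aut X\<^esub> \<beta>) x"
    using ple_trans[of "\<alpha> (\<beta> x)" "\<beta> x" x] ple_trans[of x "\<beta> x" "\<alpha> (\<beta> x)"]
    by (auto simp: aut_cone_iff)
qed

text \<open>At \<open>x = \<beta> y\<close> the conjugate takes the value
  \<open>\<beta> (\<alpha> y)\<close>. Since \<beta> is monotone, the equivalence of
  \<open>\<alpha> y\<close> and \<open>y\<close> carries over to \<open>\<beta> (\<alpha> y)\<close>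
  and \<open>x\<close>.\<close>

lemma conj_aut_cone:
  assumes "\<alpha> \<in> aut_cone X" "\<beta> \<in> carrier (Aut X)"
  shows "\<beta> \<otimes>\<^bsub>Aut X\<^esub> \<alpha> \<otimes>\<^bsub>Aut X\<^esub> inv\<^bsub>Aut X\<^esub> \<beta> \<in> aut_cone X"
  unfolding aut_cone_iff
proof (intro conjI ballI)
  have *: "\<alpha> \<in> carrier (Aut X)"
    using assms by (auto simp: aut_cone_iff)
  with assms(2) show "\<beta> \<otimes>\<^bsub>Aut X\<^esub> \<alpha> \<otimes>\<^bsub>Aut X\<^esub> inv\<^bsub>Aut X\<^esub> \<beta> \<in> carrier (Aut X)"
    by simp
  fix x assume x: "x \<in> carrier X"
  define y where "y = (inv\<^bsub>Aut X\<^esub> \<beta>) x"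
  have y: "y \<in> carrier X" "x = \<beta> y"
    using x assms(2) by (auto simp: y_def)
  show "(\<beta> \<otimes>\<^bsub>Aut X\<^esub> \<alpha> \<otimes>\<^bsub>Aut X\<^esub> inv\<^bsub>Aut X\<^esub> \<beta>) x \<preceq> x"
    "x \<preceq> (\<beta> \<otimes>\<^bsub>Aut X\<^esub> \<alpha> \<otimes>\<^bsub>Aut X\<^esub> inv\<^bsub>Aut X\<^esub> \<beta>) x"
    using * y assms by (auto simp: Aut_ple aut_cone_iff)
qed

lemma aut_cone_subset: "aut_cone X \<subseteq> carrier (Aut X)"
  by (auto simp: aut_cone_iff)

lemma AutP_simps [simp]:
  "carrier (AutP X) = carrier (Aut X)"
  "monoid.mult (AutP X) = monoid.mult (Aut X)"
  "one (AutP X) = one (Aut X)"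
  "hom (AutP X) Y = hom (Aut X) Y" "hom Z (AutP X) = hom Z (Aut X)"
  by (simp_all add: AutP_def)

lemma pos_cone_AutP [simp]: "pos_cone (AutP X) = aut_cone X"
  unfolding AutP_def by (rule pos_cone_with_cone[OF group_Aut aut_cone_subset])

lemma ordered_group_AutP: "ordered_group (AutP X)"
  unfolding AutP_def
  by (rule ordered_group_with_cone[OF group_Aut aut_cone_subset one_aut_cone mult_aut_cone conj_aut_cone])

section \<open>The product order on the semidirect product\<close>

private abbreviation "SP \<equiv> with_cone (semidirect X) (pos_cone X \<times> aut_cone X)"

lemma SP_cone_subset: "pos_cone X \<times> aut_cone X \<subseteq> carrier (semidirect X)"
  using aut_cone_subset by (auto simp: pos_cone_def)

lemma pos_cone_SP [simp]: "pos_cone SP = pos_cone X \<times> aut_cone X"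
  by (rule pos_cone_with_cone[OF group_semidirect SP_cone_subset])

lemma one_pos_cone: "\<one> \<in> pos_cone X"
  by (simp add: pos_cone_def ple_refl)

lemma pos_cone_mult: "p \<in> pos_cone X \<Longrightarrow> q \<in> pos_cone X \<Longrightarrow> p \<otimes> q \<in> pos_cone X"
  using ple_mono[of \<one> p \<one> q] by (simp add: pos_cone_def)

lemma pos_cone_Aut: "p \<in> pos_cone X \<Longrightarrow> \<alpha> \<in> carrier (Aut X) \<Longrightarrow> \<alpha> p \<in> pos_cone X"
  using Aut_ple[of \<alpha> \<one> p] by (simp add: pos_cone_def)

text \<open>Products stay in the cone because automorphisms keep positive elements positive.
  Conjugates stay in it because \<gamma>, being in \<open>aut_cone X\<close>, moves elements only
  within their equivalence classes.\<close>

lemma ordered_group_SP: "ordered_group SP"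
proof (rule ordered_group_with_cone[OF group_semidirect SP_cone_subset])
  show "\<one>\<^bsub>semidirect X\<^esub> \<in> pos_cone X \<times> aut_cone X"
    by (simp add: one_aut_cone one_pos_cone)
next
  fix p q assume "p \<in> pos_cone X \<times> aut_cone X" "q \<in> pos_cone X \<times> aut_cone X"
  then show "p \<otimes>\<^bsub>semidirect X\<^esub> q \<in> pos_cone X \<times> aut_cone X"
    using aut_cone_subset by (clarsimp simp: mult_aut_cone pos_cone_mult pos_cone_Aut subsetD)
next
  fix p q assume "p \<in> pos_cone X \<times> aut_cone X" "q \<in> carrier (semidirect X)"
  then obtain x \<alpha> y \<beta> where p: "p = (x, \<alpha>)" "x \<in> pos_cone X" "\<alpha> \<in> aut_cone X"
    and q: "q = (y, \<beta>)" "y \<in> carrier X" "\<beta> \<in> carrier (Aut X)"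
    by auto
  define \<gamma> where "\<gamma> = \<beta> \<otimes>\<^bsub>Aut X\<^esub> \<alpha> \<otimes>\<^bsub>Aut X\<^esub> inv\<^bsub>Aut X\<^esub> \<beta>"
  have c: "x \<in> carrier X" "\<alpha> \<in> carrier (Aut X)"
    using p aut_cone_subset by (auto simp: pos_cone_def)
  have \<gamma>: "\<gamma> \<in> aut_cone X" "\<gamma> \<in> carrier (Aut X)"
    using conj_aut_cone[OF p(3) q(3)] aut_cone_subset by (auto simp: \<gamma>_def)
  have "q \<otimes>\<^bsub>semidirect X\<^esub> p \<otimes>\<^bsub>semidirect X\<^esub> inv\<^bsub>semidirect X\<^esub> q
      = (y \<otimes> \<beta> x \<otimes> \<gamma> (inv y), \<gamma>)"
    using q c by (simp add: p \<gamma>_def)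
  moreover have "y \<otimes> \<beta> x \<otimes> \<gamma> (inv y) \<in> pos_cone X"
  proof -
    have "\<one> \<preceq> y \<otimes> \<beta> x \<otimes> inv y"
      using pos_cone_conj[OF X pos_cone_Aut[OF p(2) q(3)] q(2)] by (simp add: pos_cone_def)
    \<comment> \<open>The first component differs from an honest conjugate of
      \<open>\<beta> x\<close> only by \<gamma> on the last factor, and
      \<open>inv y \<preceq> \<gamma> (inv y)\<close>.\<close>
    moreover have "y \<otimes> \<beta> x \<otimes> inv y \<preceq> y \<otimes> \<beta> x \<otimes> \<gamma> (inv y)"
      using \<gamma> c q by (intro ple_mono ple_refl) (auto simp: aut_cone_iff)
    ultimately show ?thesis
      using \<gamma>(2) c q ple_trans[of \<one> "y \<otimes> \<beta> x \<otimes> inv y" "y \<otimes> \<beta> x \<otimes> \<gamma> (inv y)"]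
      by (simp add: pos_cone_def)
  qed
  ultimately show "q \<otimes>\<^bsub>semidirect X\<^esub> p \<otimes>\<^bsub>semidirect X\<^esub> inv\<^bsub>semidirect X\<^esub> q
      \<in> pos_cone X \<times> aut_cone X"
    using \<gamma> by simp
qed

section \<open>The automorphism point is a rali point\<close>

lemma aut_point_simps [simp]:
  "Total (aut_point X) = SP"
  "Base (aut_point X) = AutP X"
  "x \<in> carrier X \<Longrightarrow> ker_map (aut_point X) x = (x, \<one>\<^bsub>Aut X\<^esub>)"
  "p \<in> carrier (semidirect X) \<Longrightarrow> proj (aut_point X) p = snd p"
  "\<alpha> \<in> carrier (Aut X) \<Longrightarrow> sect (aut_point X) \<alpha> = (\<one>, \<alpha>)"
  by (simp_all add: aut_point_def)

lemma proj_aut_point_Pair [simp]: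
  "x \<in> carrier X \<Longrightarrow> \<alpha> \<in> carrier (Aut X) \<Longrightarrow> proj (aut_point X) (x, \<alpha>) = \<alpha>"
  by simp

lemma ker_map_ordhom: "ker_map (aut_point X) \<in> ordhom X SP"
proof (rule ordhomI_pos_cone[OF X ordered_group_SP])
  show "ker_map (aut_point X) \<in> hom X SP"
    by (auto simp: hom_def)
  show "ker_map (aut_point X) \<in> extensional (carrier X)"
    by (simp add: aut_point_def)
  show "ker_map (aut_point X) x \<in> pos_cone SP" if "x \<in> pos_cone X" for x
    using that by (simp add: one_aut_cone) (simp add: pos_cone_def one_aut_cone)
qed

lemma proj_ordhom: "proj (aut_point X) \<in> ordhom SP (AutP X)"
proof (rule ordhomI_pos_cone[OF ordered_group_SP ordered_group_AutP])
  show "proj (aut_point X) \<in> hom SP (AutP X)"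
    by (auto simp: hom_def simp del: aut_point_simps(4))
  show "proj (aut_point X) \<in> extensional (carrier SP)"
    by (simp add: aut_point_def)
  show "proj (aut_point X) p \<in> pos_cone (AutP X)" if "p \<in> pos_cone SP" for p
    using that SP_cone_subset by auto
qed

lemma sect_ordhom: "sect (aut_point X) \<in> ordhom (AutP X) SP"
proof (rule ordhomI_pos_cone[OF ordered_group_AutP ordered_group_SP])
  show "sect (aut_point X) \<in> hom (AutP X) SP"
    by (auto simp: hom_def)
  show "sect (aut_point X) \<in> extensional (carrier (AutP X))"
    by (simp add: aut_point_def)
  show "sect (aut_point X) \<alpha> \<in> pos_cone SP" if "\<alpha> \<in> pos_cone (AutP X)" for \<alpha>
  proof -
    have "\<alpha> \<in> aut_cone X"
      using that by simp
    then show ?thesis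
      using aut_cone_subset by (auto simp: one_pos_cone)
  qed
qed

lemma is_kernel_aut_point:
  "is_kernel X SP (AutP X) (ker_map (aut_point X)) (proj (aut_point X))"
  unfolding is_kernel_def
proof (intro conjI ballI)
  show "bij_betw (ker_map (aut_point X)) (carrier X) (kernel SP (AutP X) (proj (aut_point X)))"
    by (rule bij_betwI[where g = fst]) (auto simp: kernel_def)
  fix x y assume "x \<in> carrier X" "y \<in> carrier X"
  \<comment> \<open>The quotient of the images is the pair of \<open>y \<otimes> inv x\<close> and
    the identity, and the identity lies in \<open>aut_cone X\<close>.\<close>
  then show "x \<preceq> y \<longleftrightarrow> ker_map (aut_point X) x \<preceq>\<^bsub>SP\<^esub> ker_map (aut_point X) y"
    by (simp add: ple_iff_pos_cone[OF X] one_aut_cone)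
qed (rule ker_map_ordhom proj_ordhom)+

text \<open>A pair \<open>(x, \<alpha>)\<close> is the kernel element of \<open>x\<close> times
  \<open>(\<one>, \<alpha>)\<close>. A map that is trivial on the kernel therefore depends on
  \<alpha> only and factors through the projection as its composite with the section.\<close>

lemma is_cokernel_aut_point:
  "is_cokernel U X SP (AutP X) (ker_map (aut_point X)) (proj (aut_point X))"
  unfolding is_cokernel_def
proof (intro conjI allI impI)
  show "compose (carrier X) (proj (aut_point X)) (ker_map (aut_point X)) = zero_mor X (AutP X)"
    by (rule extensionalityI[of _ "carrier X"]) (auto simp: zero_mor_def compose_eq)
next
  fix C :: "'c ordgrp" and g
  assume C: "ordered_group C" and g: "g \<in> ordhom SP C"
    and 0: "compose (carrier X) g (ker_map (aut_point X)) = zero_mor X C"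
  interpret C: ordered_group C by fact
  interpret g: group_hom "semidirect X" C g
    using g by unfold_locales (simp add: ordhom_def)
  have g0: "g (x, \<one>\<^bsub>Aut X\<^esub>) = \<one>\<^bsub>C\<^esub>" if "x \<in> carrier X" for x
    using fun_cong[OF 0, of x] that by (simp add: compose_eq zero_mor_def)
  have g1: "g (x, \<alpha>) = g (\<one>, \<alpha>)" if "x \<in> carrier X" "\<alpha> \<in> carrier (Aut X)" for x \<alpha>
    using g.hom_mult[of "(x, \<one>\<^bsub>Aut X\<^esub>)" "(\<one>, \<alpha>)"] that g.hom_closed[of "(\<one>, \<alpha>)"]
    by (simp add: g0)
  show "\<exists>!h. h \<in> ordhom (AutP X) C \<and> compose (carrier SP) h (proj (aut_point X)) = g"
  proof (intro ex1I conjI)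
    let ?h = "compose (carrier (AutP X)) g (sect (aut_point X))"
    show "?h \<in> ordhom (AutP X) C"
    proof (rule ordhomI_pos_cone[OF ordered_group_AutP C])
      show "?h \<in> hom (AutP X) C"
        using A.hom_compose[of "sect (aut_point X)" SP g C] sect_ordhom g
        by (simp add: ordhom_def)
      show "?h x \<in> pos_cone C" if "x \<in> pos_cone (AutP X)" for x
        using ordhom_pos_cone[OF ordered_group_SP C g]
          ordhom_pos_cone[OF ordered_group_AutP ordered_group_SP sect_ordhom that] that aut_cone_subset
        by (auto simp: compose_eq)
    qed simp
    show "compose (carrier SP) ?h (proj (aut_point X)) = g"
    proof (rule extensionalityI[of _ "carrier SP"])
      fix p assume "p \<in> carrier SP"
      then show "compose (carrier SP) ?h (proj (aut_point X)) p = g p"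
        by (cases p) (simp add: compose_eq g1[symmetric])
    qed (use g in \<open>simp_all add: ordhom_def\<close>)
    fix h assume h: "h \<in> ordhom (AutP X) C \<and> compose (carrier SP) h (proj (aut_point X)) = g"
    \<comment> \<open>Evaluating \<open>g\<close> at \<open>(\<one>, \<alpha>)\<close>, which
      projects to \<alpha>, recovers \<open>h \<alpha>\<close>.\<close>
    show "h = ?h"
    proof (rule extensionalityI[of _ "carrier (AutP X)"])
      show "h \<in> extensional (carrier (AutP X))"
        using h by (simp add: ordhom_def)
      fix \<alpha> assume "\<alpha> \<in> carrier (AutP X)"
      then show "h \<alpha> = ?h \<alpha>"
        using h by (auto simp: compose_eq)
    qed simp
  qed
qed (rule ker_map_ordhom proj_ordhom)+

lemma rali_obj_aut_point: "rali_obj U X (aut_point X)"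
  unfolding rali_obj_def split_ext_def
proof (intro conjI)
  show "compose (carrier (Base (aut_point X))) (proj (aut_point X)) (sect (aut_point X))
      = id_mor (Base (aut_point X))"
    by (rule extensionalityI[of _ "carrier (AutP X)"]) (auto simp: id_mor_def compose_eq)
  show "rali (aut_point X)"
    unfolding rali_def mor_le_def
  proof
    fix p assume p: "p \<in> pos_cone (Total (aut_point X))"
    obtain x \<alpha> where [simp]: "p = (x, \<alpha>)"
      by (cases p)
    \<comment> \<open>The quotient of \<open>(x, \<alpha>)\<close> by
      \<open>(\<one>, \<alpha>)\<close> is \<open>x\<close> paired with the identity, so the rali
      inequality amounts to positivity of \<open>x\<close>.\<close>
    have "x \<in> pos_cone X" "x \<in> carrier X" "\<alpha> \<in> carrier (Aut X)"
      using p SP_cone_subset by auto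
    then show "compose (carrier (Total (aut_point X))) (sect (aut_point X)) (proj (aut_point X)) p
        \<preceq>\<^bsub>Total (aut_point X)\<^esub> id_mor (Total (aut_point X)) p"
      by (simp add: compose_eq id_mor_def one_aut_cone)
  qed
qed (simp_all add: ordered_group_SP ordered_group_AutP is_kernel_aut_point is_cokernel_aut_point
    sect_ordhom)

section \<open>The action of the base of a rali point on the kernel\<close>

context
  fixes E :: "('x, 'a, 'b) point" and U :: "'c itself"
  assumes E: "rali_obj U X E"
begin

private abbreviation "T \<equiv> Total E"
private abbreviation "B \<equiv> Base E"
private abbreviation "k \<equiv> ker_map E"
private abbreviation "f \<equiv> proj E"
private abbreviation "s \<equiv> sect E"

lemma ordered_group_Total: "ordered_group T"
  and ordered_group_Base: "ordered_group B"
  and k_ordhom: "k \<in> ordhom X T"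
  and f_ordhom: "f \<in> ordhom T B"
  and s_ordhom: "s \<in> ordhom B T"
  and bij_betw_k: "bij_betw k (carrier X) (kernel T B f)"
  and k_ple: "\<And>x y. x \<in> carrier X \<Longrightarrow> y \<in> carrier X \<Longrightarrow> k x \<preceq>\<^bsub>T\<^esub> k y \<longleftrightarrow> x \<preceq> y"
  using E by (auto simp: rali_obj_def split_ext_def is_kernel_def)

interpretation T: ordered_group T
  by (rule ordered_group_Total)
interpretation B: ordered_group B
  by (rule ordered_group_Base)
interpretation k: group_hom X T k
  using k_ordhom by unfold_locales (simp add: ordhom_def)
interpretation f: group_hom T B f
  using f_ordhom by unfold_locales (simp add: ordhom_def)
interpretation s: group_hom B T s
  using s_ordhom by unfold_locales (simp add: ordhom_def)

lemma f_s [simp]: "b \<in> carrier B \<Longrightarrow> f (s b) = b"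
proof -
  assume b: "b \<in> carrier B"
  have "compose (carrier B) f s = id_mor B"
    using E by (simp add: rali_obj_def split_ext_def)
  from fun_cong[OF this, of b] b show ?thesis
    by (simp add: compose_eq id_mor_def)
qed

lemma f_k [simp]: "x \<in> carrier X \<Longrightarrow> f (k x) = \<one>\<^bsub>B\<^esub>"
  using bij_betwE[OF bij_betw_k] by (auto simp: kernel_def)

text \<open>Used from right to left, this moves an equation in \<open>X\<close> to the total group,
  where the action is plain conjugation. The algebraic laws of \<open>act\<close> are proved
  so.\<close>

lemma k_eq_iff [simp]: "x \<in> carrier X \<Longrightarrow> y \<in> carrier X \<Longrightarrow> k x = k y \<longleftrightarrow> x = y"
  using bij_betw_k by (auto simp: bij_betw_def inj_on_def)

text \<open>The rali inequality at one element. It is applied to conjugates of \<open>s b\<close>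
  and to arbitrary positive elements.\<close>

lemma s_f_ple: "p \<in> pos_cone T \<Longrightarrow> s (f p) \<preceq>\<^bsub>T\<^esub> p"
  using E by (force simp: rali_obj_def rali_def mor_le_def pos_cone_def compose_eq id_mor_def)

text \<open>Meaningful only on the kernel of \<open>f\<close>, which is the image of
  \<open>k\<close>.\<close>

definition k_inv :: "'a \<Rightarrow> 'x" where
  "k_inv = inv_into (carrier X) k"

lemma k_inv [simp]:
  assumes "a \<in> carrier T" "f a = \<one>\<^bsub>B\<^esub>"
  shows "k (k_inv a) = a" "k_inv a \<in> carrier X"
proof -
  have *: "a \<in> kernel T B f"
    using assms by (simp add: kernel_def)
  show "k (k_inv a) = a"
    using bij_betw_inv_into_right[OF bij_betw_k *] by (simp add: k_inv_def)
  show "k_inv a \<in> carrier X"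
    using bij_betwE[OF bij_betw_inv_into[OF bij_betw_k]] * by (simp add: k_inv_def)
qed

lemma k_inv_k [simp]: "x \<in> carrier X \<Longrightarrow> k_inv (k x) = x"
  using bij_betw_inv_into_left[OF bij_betw_k] by (simp add: k_inv_def)

text \<open>The conjugate lies over the unit of the base, so \<open>k_inv\<close> applies to it.
  Restriction to the carrier makes the map extensional, as elements of \<open>Aut X\<close>
  are.\<close>

definition act :: "'b \<Rightarrow> 'x \<Rightarrow> 'x" where
  "act b = (\<lambda>x\<in>carrier X. k_inv (s b \<otimes>\<^bsub>T\<^esub> k x \<otimes>\<^bsub>T\<^esub> inv\<^bsub>T\<^esub> s b))"

lemma act_closed [simp]: "b \<in> carrier B \<Longrightarrow> x \<in> carrier X \<Longrightarrow> act b x \<in> carrier X"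
  and k_act [simp]: "b \<in> carrier B \<Longrightarrow> x \<in> carrier X \<Longrightarrow>
    k (act b x) = s b \<otimes>\<^bsub>T\<^esub> k x \<otimes>\<^bsub>T\<^esub> inv\<^bsub>T\<^esub> s b"
  by (simp_all add: act_def)

lemma act_extensional: "act b \<in> extensional (carrier X)"
  by (simp add: act_def)

lemma act_hom: "b \<in> carrier B \<Longrightarrow> act b \<in> hom X X"
  by (rule homI) (simp_all flip: k_eq_iff add: T.m_assoc)

lemma act_mult:
  "b \<in> carrier B \<Longrightarrow> c \<in> carrier B \<Longrightarrow> x \<in> carrier X \<Longrightarrow> act (b \<otimes>\<^bsub>B\<^esub> c) x = act b (act c x)"
  by (simp flip: k_eq_iff add: T.m_assoc T.inv_mult_group)

lemma act_one: "x \<in> carrier X \<Longrightarrow> act \<one>\<^bsub>B\<^esub> x = x"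
  by (simp flip: k_eq_iff)

lemma act_inv:
  "b \<in> carrier B \<Longrightarrow> x \<in> carrier X \<Longrightarrow> act (inv\<^bsub>B\<^esub> b) (act b x) = x"
  "b \<in> carrier B \<Longrightarrow> x \<in> carrier X \<Longrightarrow> act b (act (inv\<^bsub>B\<^esub> b) x) = x"
  by (simp_all flip: act_mult add: act_one)

text \<open>Conjugation is monotone in the total group, and \<open>k\<close> reflects the order
  because a kernel carries the induced order.\<close>

lemma act_mono:
  assumes "b \<in> carrier B" "x \<in> carrier X" "y \<in> carrier X" "x \<preceq> y"
  shows "act b x \<preceq> act b y"
proof -
  have "k (act b x) \<preceq>\<^bsub>T\<^esub> k (act b y)"
    using assms by (simp add: ordered_group_conj_mono[OF ordered_group_Total] k_ple)
  with assms show ?thesis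
    by (simp add: k_ple del: k_act)
qed

lemma act_Aut: "b \<in> carrier B \<Longrightarrow> act b \<in> carrier (Aut X)"
  unfolding Aut_iff
proof (intro conjI ballI)
  assume b: "b \<in> carrier B"
  show "act b \<in> hom X X"
    using b by (rule act_hom)
  have "bij_betw (act b) (carrier X) (carrier X)"
    by (rule bij_betwI[where g = "act (inv\<^bsub>B\<^esub> b)"]) (use b in \<open>auto simp: act_inv\<close>)
  then show "act b \<in> Bij (carrier X)"
    by (simp add: Bij_def act_extensional)
  \<comment> \<open>Reflection of the order is monotonicity of the action of the inverse of
    \<open>b\<close>, which undoes \<open>act b\<close>.\<close>
  fix x y assume "x \<in> carrier X" "y \<in> carrier X"
  then show "act b x \<preceq> act b y \<longleftrightarrow> x \<preceq> y"
    using act_mono[OF b, of x y] act_mono[of "inv\<^bsub>B\<^esub> b" "act b x" "act b y"] b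
    by (auto simp: act_inv)
qed

lemma act_hom_Aut: "act \<in> hom B (Aut X)"
proof (rule homI)
  fix b c assume bc: "b \<in> carrier B" "c \<in> carrier B"
  show "act (b \<otimes>\<^bsub>B\<^esub> c) = act b \<otimes>\<^bsub>Aut X\<^esub> act c"
    by (rule extensionalityI[of _ "carrier X"])
      (use bc in \<open>simp_all add: act_extensional Aut_extensional act_Aut act_mult\<close>)
qed (rule act_Aut)

text \<open>
  The rali condition applied to the conjugate of \<open>s b\<close> by \<open>k x\<close>, a positive element over \<open>b\<close>,
  gives \<open>s b \<otimes> k x \<preceq> k x \<otimes> s b\<close>; the other inequality is the case of \<open>inv x\<close>.
\<close>

lemma act_aut_cone:
  assumes "b \<in> pos_cone B"
  shows "act b \<in> aut_cone X"
proof -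
  have b: "b \<in> carrier B"
    using assms by (simp add: pos_cone_def)
  have sb: "s b \<in> pos_cone T"
    using ordhom_pos_cone[OF ordered_group_Base ordered_group_Total s_ordhom assms] .
  have le: "act b x \<preceq> x" if x: "x \<in> carrier X" for x
  proof -
    define p where "p = k x \<otimes>\<^bsub>T\<^esub> s b \<otimes>\<^bsub>T\<^esub> inv\<^bsub>T\<^esub> k x"
    have p: "p \<in> carrier T" "f p = b"
      using x b by (simp_all add: p_def)
    have "p \<in> pos_cone T"
      unfolding p_def using pos_cone_conj[OF ordered_group_Total sb] x by simp
    then have "s b \<preceq>\<^bsub>T\<^esub> p"
      using s_f_ple p by fastforce
    \<comment> \<open>Right multiplication by \<open>k x\<close> and the inverse of
      \<open>s b\<close> turns the left side into \<open>k (act b x)\<close> and collapses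
      \<open>p\<close> on the right side to \<open>k x\<close>.\<close>
    then have "s b \<otimes>\<^bsub>T\<^esub> (k x \<otimes>\<^bsub>T\<^esub> inv\<^bsub>T\<^esub> s b) \<preceq>\<^bsub>T\<^esub> p \<otimes>\<^bsub>T\<^esub> (k x \<otimes>\<^bsub>T\<^esub> inv\<^bsub>T\<^esub> s b)"
      using x b p by (intro T.ple_mono T.ple_refl) simp_all
    then have "k (act b x) \<preceq>\<^bsub>T\<^esub> k x"
      using x b by (simp add: p_def T.m_assoc)
    with x b show ?thesis
      by (simp add: k_ple del: k_act)
  qed
  have "x \<preceq> act b x" if x: "x \<in> carrier X" for x
  proof -
    have "act b (inv x) = inv (act b x)"
      using x b by (simp flip: k_eq_iff add: T.m_assoc T.inv_mult_group)
    then show ?thesis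
      using inv_antimono[OF X _ _ le[of "inv x"]] x b by simp
  qed
  with le b show ?thesis
    by (simp add: aut_cone_iff act_Aut)
qed

section \<open>Existence and uniqueness of the morphism to the automorphism point\<close>

definition act_mor :: "'b \<Rightarrow> 'x \<Rightarrow> 'x" where
  "act_mor = (\<lambda>b\<in>carrier B. act b)"

text \<open>The first component is the factor \<open>x\<close> in the decomposition of
  \<open>a\<close> as \<open>k x\<close> times \<open>s (f a)\<close>. As for
  \<open>act_mor\<close>, the restriction makes the map an extensional morphism.\<close>

definition total_mor :: "'a \<Rightarrow> 'x \<times> ('x \<Rightarrow> 'x)" where
  "total_mor = (\<lambda>a\<in>carrier T. (k_inv (a \<otimes>\<^bsub>T\<^esub> inv\<^bsub>T\<^esub> s (f a)), act (f a)))"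

lemma act_mor_ordhom: "act_mor \<in> ordhom B (AutP X)"
proof (rule ordhomI_pos_cone[OF ordered_group_Base ordered_group_AutP])
  show "act_mor \<in> hom B (AutP X)"
    by (rule homI) (simp_all add: act_mor_def act_Aut hom_mult[OF act_hom_Aut])
  show "act_mor b \<in> pos_cone (AutP X)" if "b \<in> pos_cone B" for b
    using that act_aut_cone by (simp add: act_mor_def pos_cone_def[of B])
qed (simp add: act_mor_def)

lemma total_mor_ordhom: "total_mor \<in> ordhom T SP"
proof (rule ordhomI_pos_cone[OF ordered_group_Total ordered_group_SP])
  show "total_mor \<in> hom T SP"
  proof (rule homI)
    fix a assume "a \<in> carrier T"
    then show "total_mor a \<in> carrier SP"
      by (simp add: total_mor_def act_Aut)
  next
    fix a c assume ac: "a \<in> carrier T" "c \<in> carrier T"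
    \<comment> \<open>Under \<open>k\<close> both sides become \<open>a\<close> times
      \<open>c\<close> times the inverses of \<open>s (f c)\<close> and \<open>s (f a)\<close>: on
      the right, the conjugation by \<open>s (f a)\<close> absorbs the inverse that stands before
      it.\<close>
    have "k_inv (a \<otimes>\<^bsub>T\<^esub> c \<otimes>\<^bsub>T\<^esub> inv\<^bsub>T\<^esub> s (f (a \<otimes>\<^bsub>T\<^esub> c)))
      = k_inv (a \<otimes>\<^bsub>T\<^esub> inv\<^bsub>T\<^esub> s (f a)) \<otimes> act (f a) (k_inv (c \<otimes>\<^bsub>T\<^esub> inv\<^bsub>T\<^esub> s (f c)))"
      using ac by (simp flip: k_eq_iff add: T.m_assoc T.inv_mult_group)
    moreover have "act (f (a \<otimes>\<^bsub>T\<^esub> c)) = act (f a) \<otimes>\<^bsub>Aut X\<^esub> act (f c)"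
      using ac act_hom_Aut by (simp add: hom_def)
    ultimately show "total_mor (a \<otimes>\<^bsub>T\<^esub> c) = total_mor a \<otimes>\<^bsub>SP\<^esub> total_mor c"
      using ac by (simp add: total_mor_def del: f.hom_mult)
  qed
  show "total_mor p \<in> pos_cone SP" if p: "p \<in> pos_cone T" for p
  proof -
    have pc: "p \<in> carrier T"
      using p by (simp add: pos_cone_def)
    define x where "x = k_inv (p \<otimes>\<^bsub>T\<^esub> inv\<^bsub>T\<^esub> s (f p))"
    have x: "x \<in> carrier X" "k x = p \<otimes>\<^bsub>T\<^esub> inv\<^bsub>T\<^esub> s (f p)"
      using pc by (simp_all add: x_def)
    \<comment> \<open>As \<open>k x\<close> is the quotient of \<open>p\<close> by
      \<open>s (f p)\<close>, its positivity is the rali inequality at \<open>p\<close>.\<close>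
    have "k x \<in> pos_cone T"
      unfolding x(2) using s_f_ple[OF p] pc by (simp add: ple_iff_pos_cone[OF ordered_group_Total])
    then have "x \<in> pos_cone X"
      using x(1) k_ple[of \<one> x] by (simp add: pos_cone_def)
    moreover have "act (f p) \<in> aut_cone X"
      using act_aut_cone[OF ordhom_pos_cone[OF ordered_group_Total ordered_group_Base f_ordhom p]] .
    ultimately show ?thesis
      using pc by (simp add: total_mor_def x_def)
  qed
qed (simp add: total_mor_def)

lemma mor_mem_rali_hom: "(total_mor, act_mor) \<in> rali_hom X E (aut_point X)"
proof -
  \<comment> \<open>Elements of the kernel lie over the unit, so their second component is the
    identity automorphism.\<close>
  have "act \<one>\<^bsub>B\<^esub> = \<one>\<^bsub>Aut X\<^esub>"
    using hom_one[OF act_hom_Aut B.is_group group_Aut] .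
  then have "compose (carrier X) total_mor k = ker_map (aut_point X)"
    by (intro extensionalityI[of _ "carrier X"])
      (auto simp: compose_eq total_mor_def aut_point_def)
  moreover have "compose (carrier T) (proj (aut_point X)) total_mor = compose (carrier T) act_mor f"
    by (rule extensionalityI[of _ "carrier T"])
      (auto simp: compose_eq total_mor_def act_mor_def act_Aut)
  \<comment> \<open>On \<open>s b\<close> the kernel part is the unit, which matches the first
    component of the section of the automorphism point.\<close>
  moreover have "k_inv \<one>\<^bsub>T\<^esub> = \<one>"
    using k_inv_k[of \<one>] by simp
  then have "compose (carrier B) total_mor s = compose (carrier B) (sect (aut_point X)) act_mor"
    by (intro extensionalityI[of _ "carrier B"])
      (auto simp: compose_eq total_mor_def act_mor_def act_Aut)
  ultimately show ?thesis
    by (simp add: rali_hom_def total_mor_ordhom act_mor_ordhom)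
qed

text \<open>Compatibility with kernels and sections gives \<open>u\<close> on each
  \<open>k x\<close>, and on each \<open>s b\<close> in terms of \<open>v b\<close>. These elements
  generate the total group, so it remains to see that \<open>v b\<close> is the action of
  \<open>b\<close>.\<close>

lemma rali_hom_unique:
  assumes "(u, v) \<in> rali_hom X E (aut_point X)"
  shows "u = total_mor" "v = act_mor"
proof -
  have u: "u \<in> ordhom T SP" and v: "v \<in> ordhom B (AutP X)"
    and uk: "compose (carrier X) u k = ker_map (aut_point X)"
    and us: "compose (carrier B) u s = compose (carrier B) (sect (aut_point X)) v"
    using assms by (auto simp: rali_hom_def)
  interpret u: group_hom T "semidirect X" u
    using u by unfold_locales (simp add: ordhom_def)
  have vc: "v b \<in> carrier (Aut X)" if "b \<in> carrier B" for b
    using v that by (auto simp: ordhom_def hom_def)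
  have uk: "u (k x) = (x, \<one>\<^bsub>Aut X\<^esub>)" if "x \<in> carrier X" for x
    using fun_cong[OF uk, of x] that by (simp add: compose_eq)
  have us: "u (s b) = (\<one>, v b)" if "b \<in> carrier B" for b
    using fun_cong[OF us, of b] that vc by (simp add: compose_eq)
  have v_act: "v b = act b" if b: "b \<in> carrier B" for b
  proof (rule extensionalityI[of _ "carrier X"])
    fix x assume x: "x \<in> carrier X"
    \<comment> \<open>Applying \<open>u\<close> to this commutation rule and comparing first
      components gives \<open>v b x\<close> on the left and \<open>act b x\<close> on the
      right.\<close>
    have "s b \<otimes>\<^bsub>T\<^esub> k x = k (act b x) \<otimes>\<^bsub>T\<^esub> s b"
      using b x by (simp add: T.m_assoc)
    then have "u (s b) \<otimes>\<^bsub>semidirect X\<^esub> u (k x) = u (k (act b x)) \<otimes>\<^bsub>semidirect X\<^esub> u (s b)"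
      using b x by (simp flip: u.hom_mult del: k_act)
    then show "v b x = act b x"
      using b x vc by (simp add: us uk del: k_act)
  qed (use b in \<open>simp_all add: vc Aut_extensional act_extensional\<close>)
  show "v = act_mor"
    by (rule extensionalityI[of _ "carrier B"])
      (use v in \<open>simp_all add: act_mor_def v_act ordhom_def\<close>)
  show "u = total_mor"
  proof (rule extensionalityI[of _ "carrier T"])
    fix a assume a: "a \<in> carrier T"
    define x where "x = k_inv (a \<otimes>\<^bsub>T\<^esub> inv\<^bsub>T\<^esub> s (f a))"
    have x: "x \<in> carrier X" "k x = a \<otimes>\<^bsub>T\<^esub> inv\<^bsub>T\<^esub> s (f a)"
      using a by (simp_all add: x_def)
    have "u a = u (k x \<otimes>\<^bsub>T\<^esub> s (f a))"
      using a by (simp add: x(2) T.m_assoc)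
    also have "\<dots> = u (k x) \<otimes>\<^bsub>semidirect X\<^esub> u (s (f a))"
      using a x(1) by simp
    also have "\<dots> = (x, act (f a))"
      using a x(1) by (simp add: uk us v_act act_Aut)
    also have "\<dots> = total_mor a"
      using a by (simp add: total_mor_def x_def)
    finally show "u a = total_mor a" .
  qed (use u in \<open>simp_all add: ordhom_def total_mor_def\<close>)
qed

lemma ex1_rali_hom: "\<exists>!m. m \<in> rali_hom X E (aut_point X)"
proof (rule ex1I[of _ "(total_mor, act_mor)"])
  show "m = (total_mor, act_mor)" if "m \<in> rali_hom X E (aut_point X)" for m
    using that by (cases m) (metis rali_hom_unique)
qed (rule mor_mem_rali_hom)

end

end

theorem theorem5p3:
  fixes X :: "'x ordgrp"
  assumes "ordered_group X"
  shows "rali_obj TYPE('c) X (aut_point X) \<and>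
    (\<forall>E :: ('x, 'a, 'b) point. rali_obj TYPE('c) X E \<longrightarrow>
       (\<exists>!m. m \<in> rali_hom X E (aut_point X)))"
  using rali_obj_aut_point[OF assms] ex1_rali_hom[OF assms] by blast

end
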